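(* Let $X,Y$ be locally convex Hausdorff topological vector spaces, let $\varphi\colon X\times Y\to\overline{\mathbb{R}}$ be a function, $F\colon X\rightrightarrows Y$ a multifunction, and let $\mu\colon X\to\overline{\mathbb{R}}$ be the optimal value function $$\mu(x)=\inf\{\varphi(x,y)\mid y\in F(x)\},\quad x\in X.$$ If $\varphi$ is a proper polyhedral convex function and $F$ is a polyhedral convex multifunction, then $\mu$ is a polyhedral convex function.
   Context: All vector spaces are real; $\overline{\mathbb{R}}=[-\infty,\infty]$ and $\inf\emptyset=\infty$. A subset $D$ of a locally convex Hausdorff topological vector space $E$ is a polyhedral convex set if there exist finitely many continuous linear functionals $e_i^*\in E^*$ and $\alpha_i\in\mathbb{R}$, $i=1,\dots,m$, such that $D=\{e\in E\mid \langle e_i^*,e\rangle\le\alpha_i,\ i=1,\dots,m\}$ (the empty set is included). For $f\colon E\to\overline{\mathbb{R}}$, $\mathrm{epi}\,f=\{(e,\lambda)\in E\times\mathbb{R}\mid f(e)\le\lambda\}$; $f$ is a polyhedral convex function if $\mathrm{epi}\,f$ is a polyhedral convex set in $E\times\mathbb{R}$. $f$ is proper if it never takes the value $-\infty$ and is not identically $+\infty$. A multifunction $F\colon X\rightrightarrows Y$ (a map assigning to each $x\in X$ a possibly empty subset $F(x)\subset Y$) is polyhedral convex if its graph $\{(x,y)\in X\times Y\mid y\in F(x)\}$ is a polyhedral convex set in $X\times Y$. *)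

theory Defs
  imports "HOL-Analysis.Analysis"
begin

text \<open>
  Locally convex Hausdorff topological vector spaces over the reals. A class specification cannot
  mention \<^const>\<open>convex\<close>, which already has a sort constraint, so its definition is unfolded in the
  last axiom; lemma \<open>locally_convex\<close> restates that axiom with \<^const>\<open>convex\<close>.
\<close>

class locally_convex_space = real_vector + topological_ab_group_add + t2_space +
  assumes tendsto_scaleR_Pair:
    "LIM p (nhds c \<times>\<^sub>F nhds x). fst p *\<^sub>R snd p :> nhds (c *\<^sub>R x)"
  and ex_open_convex_subset:
    "open U \<Longrightarrow> x \<in> U \<Longrightarrow> \<exists>V. open V \<and> x \<in> V \<and> V \<subseteq> U \<and>
       (\<forall>y\<in>V. \<forall>z\<in>V. \<forall>u\<ge>0. \<forall>v\<ge>0. u + v = 1 \<longrightarrow> u *\<^sub>R y + v *\<^sub>R z \<in> V)"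

lemma locally_convex:
  fixes U :: "'a::locally_convex_space set"
  shows "open U \<Longrightarrow> x \<in> U \<Longrightarrow> \<exists>V. open V \<and> x \<in> V \<and> V \<subseteq> U \<and> convex V"
  using ex_open_convex_subset[of U x] unfolding convex_def .

instance real_normed_vector \<subseteq> locally_convex_space
proof
  fix c :: real and x :: 'a
  have *: "((\<lambda>p. p) \<longlongrightarrow> (c, x)) (nhds (c, x))"
    by (simp add: filterlim_def)
  have "((\<lambda>p. fst p *\<^sub>R snd p) \<longlongrightarrow> c *\<^sub>R x) (nhds (c, x))"
    using tendsto_scaleR[OF tendsto_fst[OF *] tendsto_snd[OF *]] by simp
  then show "LIM p (nhds c \<times>\<^sub>F nhds x). fst p *\<^sub>R snd p :> nhds (c *\<^sub>R x)"
    by (simp add: nhds_prod)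
next
  fix U :: "'a set" and x
  assume "open U" "x \<in> U"
  then obtain e where "e > 0" "ball x e \<subseteq> U"
    using open_contains_ball by blast
  then show "\<exists>V. open V \<and> x \<in> V \<and> V \<subseteq> U \<and>
      (\<forall>y\<in>V. \<forall>z\<in>V. \<forall>u\<ge>0. \<forall>v\<ge>0. u + v = 1 \<longrightarrow> u *\<^sub>R y + v *\<^sub>R z \<in> V)"
    unfolding convex_def[symmetric]
    by (intro exI[of _ "ball x e"]) simp
qed

instance prod :: (topological_monoid_add, topological_monoid_add) topological_monoid_add
proof
  fix a b :: "'a \<times> 'b"
  have *: "((\<lambda>p. p) \<longlongrightarrow> (a, b)) (nhds (a, b))"
    by (simp add: filterlim_def)
  have "((\<lambda>p. fst p + snd p) \<longlongrightarrow> a + b) (nhds (a, b))"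
    using tendsto_Pair[OF
        tendsto_add[OF tendsto_fst[OF tendsto_fst[OF *]] tendsto_fst[OF tendsto_snd[OF *]]]
        tendsto_add[OF tendsto_snd[OF tendsto_fst[OF *]] tendsto_snd[OF tendsto_snd[OF *]]]]
    by (simp add: plus_prod_def)
  then show "LIM p (nhds a \<times>\<^sub>F nhds b). fst p + snd p :> nhds (a + b)"
    by (simp add: nhds_prod)
qed

instance prod :: (topological_group_add, topological_group_add) topological_group_add
proof
  fix a :: "'a \<times> 'b"
  have *: "((\<lambda>p. p) \<longlongrightarrow> a) (nhds a)"
    by (simp add: filterlim_def)
  show "(uminus \<longlongrightarrow> - a) (nhds a)"
    using tendsto_Pair[OF tendsto_minus[OF tendsto_fst[OF *]] tendsto_minus[OF tendsto_snd[OF *]]]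
    by (simp add: uminus_prod_def[abs_def] case_prod_unfold)
qed

instance prod :: (topological_ab_group_add, topological_ab_group_add) topological_ab_group_add ..

lemma tendsto_scaleR_locally_convex_space:
  fixes g :: "'a \<Rightarrow> 'b::locally_convex_space"
  assumes "(f \<longlongrightarrow> c) F" "(g \<longlongrightarrow> x) F"
  shows "((\<lambda>t. f t *\<^sub>R g t) \<longlongrightarrow> c *\<^sub>R x) F"
  using filterlim_compose[OF tendsto_scaleR_Pair, of "\<lambda>t. (f t, g t)" c x F] assms
  by (simp add: nhds_prod[symmetric] tendsto_Pair)

instance prod :: (locally_convex_space, locally_convex_space) locally_convex_space
proof
  fix c :: real and x :: "'a \<times> 'b"
  have *: "((\<lambda>p. p) \<longlongrightarrow> (c, x)) (nhds (c, x))"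
    by (simp add: filterlim_def)
  have "((\<lambda>p. fst p *\<^sub>R snd p) \<longlongrightarrow> c *\<^sub>R x) (nhds (c, x))"
    using tendsto_Pair[OF
        tendsto_scaleR_locally_convex_space[OF tendsto_fst[OF *] tendsto_fst[OF tendsto_snd[OF *]]]
        tendsto_scaleR_locally_convex_space[OF tendsto_fst[OF *] tendsto_snd[OF tendsto_snd[OF *]]]]
    by (simp add: scaleR_prod_def)
  then show "LIM p (nhds c \<times>\<^sub>F nhds x). fst p *\<^sub>R snd p :> nhds (c *\<^sub>R x)"
    by (simp add: nhds_prod)
next
  fix U :: "('a \<times> 'b) set" and x
  assume "open U" "x \<in> U"
  then obtain A B where AB: "open A" "open B" "x \<in> A \<times> B" "A \<times> B \<subseteq> U"
    by (rule open_prod_elim)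
  then obtain A' B' where "open A'" "convex A'" "fst x \<in> A'" "A' \<subseteq> A"
      "open B'" "convex B'" "snd x \<in> B'" "B' \<subseteq> B"
    using locally_convex[of A "fst x"] locally_convex[of B "snd x"] by (auto simp: mem_Times_iff)
  with AB show "\<exists>V. open V \<and> x \<in> V \<and> V \<subseteq> U \<and>
      (\<forall>y\<in>V. \<forall>z\<in>V. \<forall>u\<ge>0. \<forall>v\<ge>0. u + v = 1 \<longrightarrow> u *\<^sub>R y + v *\<^sub>R z \<in> V)"
    unfolding convex_def[symmetric]
    by (intro exI[of _ "A' \<times> B'"]) (auto simp: open_Times convex_Times mem_Times_iff)
qed

definition polyhedral_convex_set :: "'e::locally_convex_space set \<Rightarrow> bool" where
  "polyhedral_convex_set D \<longleftrightarrow>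
     (\<exists>(m::nat) (f :: nat \<Rightarrow> 'e \<Rightarrow> real) (\<alpha> :: nat \<Rightarrow> real).
        (\<forall>i\<in>{1..m}. linear (f i) \<and> continuous_on UNIV (f i)) \<and>
        D = {e. \<forall>i\<in>{1..m}. f i e \<le> \<alpha> i})"

text \<open>The library's \<^const>\<open>epigraph\<close> is only for real-valued functions.\<close>

definition epi :: "('e \<Rightarrow> ereal) \<Rightarrow> ('e \<times> real) set" where
  "epi f = {(e, r). f e \<le> ereal r}"

definition polyhedral_convex_fun :: "('e::locally_convex_space \<Rightarrow> ereal) \<Rightarrow> bool" where
  "polyhedral_convex_fun f \<longleftrightarrow> polyhedral_convex_set (epi f)"

definition proper_fun :: "('e \<Rightarrow> ereal) \<Rightarrow> bool" where
  "proper_fun f \<longleftrightarrow> (\<forall>e. f e \<noteq> -\<infinity>) \<and> (\<exists>e. f e \<noteq> \<infinity>)"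

definition multifunction_graph :: "('x \<Rightarrow> 'y set) \<Rightarrow> ('x \<times> 'y) set" where
  "multifunction_graph F = {(x, y). y \<in> F x}"

definition polyhedral_convex_multifunction ::
    "('x::locally_convex_space \<Rightarrow> 'y::locally_convex_space set) \<Rightarrow> bool" where
  "polyhedral_convex_multifunction F \<longleftrightarrow> polyhedral_convex_set (multifunction_graph F)"

text \<open>The infimum is taken in \<^typ>\<open>ereal\<close>, so it is \<open>\<infinity>\<close> when \<open>F x\<close> is empty.\<close>

definition optimal_value ::
    "('x \<times> 'y \<Rightarrow> ereal) \<Rightarrow> ('x \<Rightarrow> 'y set) \<Rightarrow> 'x \<Rightarrow> ereal" where
  "optimal_value \<phi> F x = Inf {\<phi> (x, y) | y. y \<in> F x}"

end

theory Submission
  imports Defs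
begin

text \<open>
  Where \<open>\<mu>\<close> is the optimal value function, \<open>\<mu> x \<le> r\<close> holds iff for every \<open>s > r\<close> some \<open>y \<in> F x\<close> has
  \<open>\<phi> (x, y) \<le> s\<close>. So \<open>epi \<mu>\<close> is obtained from the projection \<open>Q\<close> of the polyhedral set
  \<open>P = {((x, y), r). \<phi> (x, y) \<le> r \<and> y \<in> F x}\<close> along \<open>y\<close> by adding limits in the direction of \<open>r\<close>.
  Once \<open>Q\<close> is known to be polyhedral, it is closed, so the limits add nothing and \<open>epi \<mu> = Q\<close>
  (\<open>epi_optimal_value\<close>).

  The substance is that \<open>Q\<close> is polyhedral although \<open>y\<close> ranges over a space of arbitrary dimension.
  The projection is a slice of \<open>P + L\<close>, where \<open>L\<close> is the subspace of the vectors \<open>((0, y), 0)\<close>, and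
  \<open>P + L\<close> is polyhedral for every subspace \<open>L\<close> (\<open>polyhedral_convex_set_add_subspace\<close>): the finitely
  many functionals that define \<open>P\<close> only see a finite-dimensional quotient of \<open>L\<close>, so \<open>L\<close> can be split
  off one line at a time, and adding a line is one step of Fourier--Motzkin elimination
  (\<open>polyhedral_convex_set_add_line\<close>).
\<close>

section \<open>Finite systems of linear inequalities\<close>

definition solution_set :: "(('e \<Rightarrow> real) \<times> real) set \<Rightarrow> 'e set" where
  "solution_set S = {e. \<forall>(f, a)\<in>S. f e \<le> a}"

definition continuous_linear_system :: "(('e::locally_convex_space \<Rightarrow> real) \<times> real) set \<Rightarrow> bool" where
  "continuous_linear_system S \<longleftrightarrow>
     finite S \<and> (\<forall>(f, a)\<in>S. linear f \<and> continuous_on UNIV f)"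

text \<open>
  Systems indexed by a finite set, instead of by an initial segment of the positive integers, can be
  united and split without renumbering.
\<close>

lemma polyhedral_convex_set_iff_solution_set:
  "polyhedral_convex_set D \<longleftrightarrow> (\<exists>S. continuous_linear_system S \<and> D = solution_set S)"
proof
  assume "polyhedral_convex_set D"
  then obtain m :: nat and f :: "nat \<Rightarrow> _ \<Rightarrow> real" and \<alpha> where
      f: "\<And>i. i \<in> {1..m} \<Longrightarrow> linear (f i) \<and> continuous_on UNIV (f i)"
      and D: "D = {e. \<forall>i\<in>{1..m}. f i e \<le> \<alpha> i}"
    unfolding polyhedral_convex_set_def by blast
  have "continuous_linear_system ((\<lambda>i. (f i, \<alpha> i)) ` {1..m})"
    using f by (auto simp: continuous_linear_system_def)
  moreover have "D = solution_set ((\<lambda>i. (f i, \<alpha> i)) ` {1..m})"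
    by (auto simp: D solution_set_def)
  ultimately show "\<exists>S. continuous_linear_system S \<and> D = solution_set S" by blast
next
  assume "\<exists>S. continuous_linear_system S \<and> D = solution_set S"
  then obtain S where S: "continuous_linear_system S" and D: "D = solution_set S" by blast
  then obtain h where h: "bij_betw h {1..card S} S"
    using ex_bij_betw_nat_finite_1[of S] by (auto simp: continuous_linear_system_def)
  then have im: "S = h ` {1..card S}" by (simp add: bij_betw_def)
  have "linear (fst (h i)) \<and> continuous_on UNIV (fst (h i))" if "i \<in> {1..card S}" for i
  proof -
    have "h i \<in> S" using that im by blast
    then show ?thesis using S by (auto simp: continuous_linear_system_def case_prod_unfold)
  qed
  moreover have "D = {e. \<forall>i\<in>{1..card S}. fst (h i) e \<le> snd (h i)}"
    unfolding D solution_set_def by (subst im) (auto simp: case_prod_unfold)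
  ultimately show "polyhedral_convex_set D"
    unfolding polyhedral_convex_set_def
    by (intro exI[of _ "card S"] exI[of _ "\<lambda>i. fst (h i)"] exI[of _ "\<lambda>i. snd (h i)"]) blast
qed

lemma polyhedral_convex_set_Int:
  assumes "polyhedral_convex_set A" "polyhedral_convex_set B"
  shows "polyhedral_convex_set (A \<inter> B)"
proof -
  obtain S T where "continuous_linear_system S" "A = solution_set S"
      "continuous_linear_system T" "B = solution_set T"
    using assms unfolding polyhedral_convex_set_iff_solution_set by blast
  then have "continuous_linear_system (S \<union> T)" "A \<inter> B = solution_set (S \<union> T)"
    by (auto simp: continuous_linear_system_def solution_set_def)
  then show ?thesis unfolding polyhedral_convex_set_iff_solution_set by blast
qed

lemma polyhedral_convex_set_vimage:
  fixes h :: "'a::locally_convex_space \<Rightarrow> 'b::locally_convex_space"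
  assumes "polyhedral_convex_set A" "linear h" "continuous_on UNIV h"
  shows "polyhedral_convex_set (h -` A)"
proof -
  obtain m :: nat and f :: "nat \<Rightarrow> _ \<Rightarrow> real" and \<alpha> where
      f: "\<And>i. i \<in> {1..m} \<Longrightarrow> linear (f i) \<and> continuous_on UNIV (f i)"
      and A: "A = {e. \<forall>i\<in>{1..m}. f i e \<le> \<alpha> i}"
    using assms(1) unfolding polyhedral_convex_set_def by blast
  have "linear (\<lambda>x. f i (h x)) \<and> continuous_on UNIV (\<lambda>x. f i (h x))" if "i \<in> {1..m}" for i
    using f[OF that] assms(2,3) linear_compose[of h "f i"]
      continuous_on_compose2[of UNIV "f i" UNIV h]
    by (auto simp: o_def)
  then show ?thesis
    unfolding polyhedral_convex_set_def A
    by (intro exI[of _ m] exI[of _ "\<lambda>i x. f i (h x)"] exI[of _ \<alpha>]) auto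
qed

lemma closed_polyhedral_convex_set:
  assumes "polyhedral_convex_set A"
  shows "closed A"
proof -
  obtain m :: nat and f :: "nat \<Rightarrow> _ \<Rightarrow> real" and \<alpha> where
      f: "\<And>i. i \<in> {1..m} \<Longrightarrow> continuous_on UNIV (f i)"
      and A: "A = {e. \<forall>i\<in>{1..m}. f i e \<le> \<alpha> i}"
    using assms unfolding polyhedral_convex_set_def by blast
  have "A = (\<Inter>i\<in>{1..m}. {e. f i e \<le> \<alpha> i})" by (auto simp: A)
  then show ?thesis
    using f by (auto intro!: closed_INT closed_Collect_le)
qed

section \<open>Fourier--Motzkin elimination\<close>

lemma real_between_finite_sets:
  fixes A B :: "real set"
  assumes "finite A" "finite B" "\<And>a b. a \<in> A \<Longrightarrow> b \<in> B \<Longrightarrow> a \<le> b"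
  shows "\<exists>t. (\<forall>a\<in>A. a \<le> t) \<and> (\<forall>b\<in>B. t \<le> b)"
proof (cases "A = {}")
  case True
  then show ?thesis
    using assms(2) bdd_below_finite[of B] by (auto simp: bdd_below_def)
next
  case False
  then show ?thesis
    using assms by (intro exI[of _ "Max A"]) auto
qed

text \<open>
  On the line \<open>e + t *\<^sub>R b\<close> each inequality is an upper bound on \<open>t\<close>, a lower bound on \<open>t\<close>, or free of
  \<open>t\<close>, according to the sign of its functional at \<open>b\<close>. Some \<open>t\<close> meets all bounds iff every lower
  bound is at most every upper bound; after clearing denominators each such comparison is again a
  linear inequality in \<open>e\<close>.
\<close>

lemma polyhedral_convex_set_add_line:
  fixes b :: "'e::locally_convex_space"
  assumes "polyhedral_convex_set D"
  shows "polyhedral_convex_set {e. \<exists>t. e + t *\<^sub>R b \<in> D}"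
proof -
  obtain S where S: "continuous_linear_system S" and D: "D = solution_set S"
    using assms unfolding polyhedral_convex_set_iff_solution_set by blast
  have fin: "finite S"
    and lin: "\<And>f a. (f, a) \<in> S \<Longrightarrow> linear f"
    and cont: "\<And>f a. (f, a) \<in> S \<Longrightarrow> continuous_on UNIV f"
    using S by (auto simp: continuous_linear_system_def)
  define Z where "Z = {p \<in> S. fst p b = 0}"
  define U where "U = {p \<in> S. fst p b > 0}"
  define V where "V = {p \<in> S. fst p b < 0}"
  define comb :: "(('e \<Rightarrow> real) \<times> real) \<times> (('e \<Rightarrow> real) \<times> real) \<Rightarrow> ('e \<Rightarrow> real) \<times> real"
    where "comb = (\<lambda>((f, a), (g, c)). (\<lambda>e. (- g b) * f e + f b * g e, (- g b) * a + f b * c))"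
  define T where "T = Z \<union> comb ` (U \<times> V)"
  have "continuous_linear_system T"
    unfolding continuous_linear_system_def
  proof (intro conjI ballI)
    show "finite T" using fin by (auto simp: T_def Z_def U_def V_def)
  next
    fix p assume "p \<in> T"
    then consider "p \<in> S"
      | f a g c where "(f, a) \<in> S" "(g, c) \<in> S" "p = comb ((f, a), (g, c))"
      by (auto simp: T_def Z_def U_def V_def)
    then show "case p of (f, a) \<Rightarrow> linear f \<and> continuous_on UNIV f"
    proof cases
      case 1
      then show ?thesis using lin cont by (cases p) auto
    next
      case 2
      have "linear (\<lambda>e. (- g b) * f e + f b * g e)"
        using lin[OF 2(1)] lin[OF 2(2)]
        by (auto simp: linear_iff algebra_simps)
      moreover have "continuous_on UNIV (\<lambda>e. (- g b) * f e + f b * g e)"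
        using cont[OF 2(1)] cont[OF 2(2)] by (intro continuous_intros)
      ultimately show ?thesis by (simp add: 2(3) comb_def)
    qed
  qed
  moreover have "{e. \<exists>t. e + t *\<^sub>R b \<in> D} = solution_set T"
  proof (intro set_eqI iffI; unfold mem_Collect_eq)
    fix e
    assume "\<exists>t. e + t *\<^sub>R b \<in> D"
    then obtain t where t: "\<And>f a. (f, a) \<in> S \<Longrightarrow> f e + t * f b \<le> a"
      by (fastforce simp: D solution_set_def linear_add[OF lin] linear_scale[OF lin])
    have "f e \<le> a" if "(f, a) \<in> Z" for f a
      using t[of f a] that by (simp add: Z_def)
    moreover have "(- g b) * f e + f b * g e \<le> (- g b) * a + f b * c"
      if "(f, a) \<in> U" "(g, c) \<in> V" for f a g c
    proof -
      have "(- g b) * (f e + t * f b) \<le> (- g b) * a"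
        using that t by (intro mult_left_mono) (auto simp: U_def V_def)
      moreover have "f b * (g e + t * g b) \<le> f b * c"
        using that t by (intro mult_left_mono) (auto simp: U_def V_def)
      ultimately show ?thesis by (simp add: algebra_simps)
    qed
    ultimately show "e \<in> solution_set T"
      by (auto simp: solution_set_def T_def comb_def)
  next
    fix e
    assume e: "e \<in> solution_set T"
    define bnd :: "(('e \<Rightarrow> real) \<times> real) \<Rightarrow> real"
      where "bnd = (\<lambda>(f, a). (a - f e) / f b)"
    have le: "bnd q \<le> bnd p" if "p \<in> U" "q \<in> V" for p q
    proof -
      obtain f a g c where pq: "p = (f, a)" "q = (g, c)" by (cases p; cases q)
      have "comb (p, q) \<in> T" using that by (auto simp: T_def)
      then have "(- g b) * f e + f b * g e \<le> (- g b) * a + f b * c"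
        using e by (fastforce simp: solution_set_def pq comb_def)
      moreover have "f b > 0" "g b < 0" using that by (auto simp: pq U_def V_def)
      ultimately show ?thesis by (simp add: pq bnd_def field_simps)
    qed
    have "finite U" "finite V" using fin by (auto simp: U_def V_def)
    then have "\<exists>t. (\<forall>x\<in>bnd ` V. x \<le> t) \<and> (\<forall>x\<in>bnd ` U. t \<le> x)"
      by (intro real_between_finite_sets) (auto intro: le)
    then obtain t where t: "\<And>q. q \<in> V \<Longrightarrow> bnd q \<le> t" "\<And>p. p \<in> U \<Longrightarrow> t \<le> bnd p"
      by blast
    have "f (e + t *\<^sub>R b) \<le> a" if fa: "(f, a) \<in> S" for f a
    proof -
      have "f e + t * f b \<le> a"
      proof (cases "f b" "0 :: real" rule: linorder_cases)
        case less
        then show ?thesis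
          using t(1)[of "(f, a)"] fa by (simp add: V_def bnd_def field_simps)
      next
        case equal
        then have "(f, a) \<in> T" using fa by (simp add: T_def Z_def)
        then show ?thesis using e equal by (auto simp: solution_set_def)
      next
        case greater
        then show ?thesis
          using t(2)[of "(f, a)"] fa by (simp add: U_def bnd_def field_simps)
      qed
      then show ?thesis by (simp add: linear_add[OF lin[OF fa]] linear_scale[OF lin[OF fa]])
    qed
    then show "\<exists>t. e + t *\<^sub>R b \<in> D" by (auto simp: D solution_set_def)
  qed
  ultimately show ?thesis unfolding polyhedral_convex_set_iff_solution_set by blast
qed

text \<open>
  The set is the sum of \<open>D\<close> and \<open>L\<close>, since \<open>L\<close> is symmetric. Induction on the number of inequalities whose functional does not vanish on \<open>L\<close>. If there is none,
  moving along \<open>L\<close> changes nothing. Otherwise a functional \<open>f\<close> with \<open>f b \<noteq> 0\<close> for some \<open>b \<in> L\<close> splits \<open>L\<close>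
  into \<open>L \<inter> {l. f l = 0}\<close>, on which strictly fewer functionals are nonzero, and the line through \<open>b\<close>.
\<close>

lemma polyhedral_convex_set_add_subspace:
  fixes D :: "'e::locally_convex_space set"
  assumes "polyhedral_convex_set D" "subspace L"
  shows "polyhedral_convex_set {e. \<exists>l\<in>L. e + l \<in> D}"
proof -
  obtain S where S: "continuous_linear_system S" and D: "D = solution_set S"
    using assms unfolding polyhedral_convex_set_iff_solution_set by blast
  have fin: "finite S" and lin: "\<And>f a. (f, a) \<in> S \<Longrightarrow> linear f"
    using S by (auto simp: continuous_linear_system_def)
  define active where "active L = {p \<in> S. \<exists>l\<in>L. fst p l \<noteq> 0}" for L
  show ?thesis
    using assms(2)
  proof (induction "card (active L)" arbitrary: L rule: less_induct)
    case less
    show ?case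
    proof (cases "active L = {}")
      case True
      have "e + l \<in> D \<longleftrightarrow> e \<in> D" if "l \<in> L" for e l
      proof -
        have "fst p (e + l) = fst p e" if p: "p \<in> S" for p
        proof -
          have "fst p l = 0" using True \<open>l \<in> L\<close> p unfolding active_def by blast
          then show ?thesis using linear_add[OF lin, of "fst p" "snd p"] p by simp
        qed
        then show ?thesis by (simp add: D solution_set_def case_prod_unfold)
      qed
      then have "{e. \<exists>l\<in>L. e + l \<in> D} = D"
        using subspace_0[OF less.prems] by auto
      then show ?thesis using assms(1) by simp
    next
      case False
      then obtain f a b where fa: "(f, a) \<in> S" and b: "b \<in> L" "f b \<noteq> 0"
        by (auto simp: active_def)
      define K where "K = L \<inter> {l. f l = 0}"
      have K: "subspace K"
        unfolding K_def
        by (intro subspace_inter less.prems linear_subspace_kernel lin[OF fa])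
      have "(f, a) \<in> active L" "(f, a) \<notin> active K" "active K \<subseteq> active L"
        using fa b by (auto simp: active_def K_def)
      then have "active K \<subset> active L" by blast
      moreover have "finite (active L)" using fin by (simp add: active_def)
      ultimately have "card (active K) < card (active L)" by (intro psubset_card_mono)
      then have "polyhedral_convex_set {e. \<exists>t. e + t *\<^sub>R b \<in> {e. \<exists>l\<in>K. e + l \<in> D}}"
        by (intro polyhedral_convex_set_add_line less.hyps K)
      also have "{e. \<exists>t. e + t *\<^sub>R b \<in> {e. \<exists>l\<in>K. e + l \<in> D}} = {e. \<exists>l\<in>L. e + l \<in> D}"
      proof (intro set_eqI iffI; unfold mem_Collect_eq)
        fix e
        assume "\<exists>t. \<exists>l\<in>K. e + t *\<^sub>R b + l \<in> D"
        then obtain t l where "l \<in> K" "e + (t *\<^sub>R b + l) \<in> D" by (auto simp: add.assoc)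
        moreover from this b have "t *\<^sub>R b + l \<in> L"
          using less.prems by (auto simp: K_def intro: subspace_add subspace_scale)
        ultimately show "\<exists>l\<in>L. e + l \<in> D" by blast
      next
        fix e
        assume "\<exists>l\<in>L. e + l \<in> D"
        then obtain l where l: "l \<in> L" "e + l \<in> D" by blast
        define t where "t = f l / f b"
        have "l - t *\<^sub>R b \<in> K"
          using l b less.prems linear_diff[OF lin[OF fa]] linear_scale[OF lin[OF fa]]
          by (auto simp: K_def t_def intro: subspace_diff subspace_scale)
        moreover have "e + t *\<^sub>R b + (l - t *\<^sub>R b) \<in> D" using l by simp
        ultimately show "\<exists>t. \<exists>l\<in>K. e + t *\<^sub>R b + l \<in> D" by blast
      qed
      finally show ?thesis .
    qed
  qed
qed

section \<open>The optimal value function\<close>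

lemma polyhedral_convex_set_project_middle:
  fixes P :: "(('x::locally_convex_space \<times> 'y::locally_convex_space) \<times> real) set"
  assumes "polyhedral_convex_set P"
  shows "polyhedral_convex_set {(x, r). \<exists>y. ((x, y), r) \<in> P}"
proof -
  define L :: "(('x \<times> 'y) \<times> real) set" where "L = range (\<lambda>y. ((0, y), 0))"
  define j :: "'x \<times> real \<Rightarrow> ('x \<times> 'y) \<times> real" where "j = (\<lambda>(x, r). ((x, 0), r))"
  have "subspace L"
    unfolding L_def
    by (intro linear_subspace_image subspace_UNIV) (auto simp: linear_iff)
  then have "polyhedral_convex_set {e. \<exists>l\<in>L. e + l \<in> P}"
    by (rule polyhedral_convex_set_add_subspace[OF assms])
  moreover have "linear j"
    by (auto simp: linear_iff j_def)
  moreover have "continuous_on UNIV j"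
    unfolding j_def case_prod_unfold by (intro continuous_intros)
  ultimately have "polyhedral_convex_set (j -` {e. \<exists>l\<in>L. e + l \<in> P})"
    by (rule polyhedral_convex_set_vimage)
  also have "j -` {e. \<exists>l\<in>L. e + l \<in> P} = {(x, r). \<exists>y. ((x, y), r) \<in> P}"
    by (auto simp: j_def L_def)
  finally show ?thesis .
qed

text \<open>
  In general the epigraph of an infimal projection is only the vertical closure of the projected
  epigraph; closedness removes the difference, and it gives attainment of finite infima.
\<close>

lemma epi_optimal_value:
  fixes \<phi> :: "'x::topological_space \<times> 'y \<Rightarrow> ereal"
  assumes closed: "closed {(x, r). \<exists>y. \<phi> (x, y) \<le> ereal r \<and> y \<in> F x}" (is "closed ?Q")
  shows "epi (optimal_value \<phi> F) = ?Q"
proof (intro set_eqI iffI)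
  fix p assume "p \<in> ?Q"
  then show "p \<in> epi (optimal_value \<phi> F)"
    by (auto simp: epi_def optimal_value_def intro: Inf_lower2)
next
  fix p assume p: "p \<in> epi (optimal_value \<phi> F)"
  obtain x r where xr: "p = (x, r)" by (cases p)
  have "(x, s) \<in> ?Q" if "r < s" for s
  proof -
    have "Inf {\<phi> (x, y) | y. y \<in> F x} < ereal s"
      using p that by (auto simp: xr epi_def optimal_value_def intro: le_less_trans)
    then show ?thesis by (auto simp: Inf_less_iff intro: less_imp_le)
  qed
  then have "(x, r + inverse (real (Suc n))) \<in> ?Q" for n by simp
  moreover have "(\<lambda>n. (x, r + inverse (real (Suc n)))) \<longlonglongrightarrow> (x, r)"
    using tendsto_add[OF tendsto_const LIMSEQ_inverse_real_of_nat, of r]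
    by (intro tendsto_Pair tendsto_const) simp
  ultimately show "p \<in> ?Q"
    unfolding xr by (rule closed_sequentially[OF closed])
qed

theorem theorem4p8:
  fixes \<phi> :: "'x::locally_convex_space \<times> 'y::locally_convex_space \<Rightarrow> ereal"
    and F :: "'x \<Rightarrow> 'y set"
  assumes "proper_fun \<phi>"
    and "polyhedral_convex_fun \<phi>"
    and "polyhedral_convex_multifunction F"
  shows "polyhedral_convex_fun (optimal_value \<phi> F)"
proof -
  define P where "P = epi \<phi> \<inter> fst -` multifunction_graph F"
  have "polyhedral_convex_set (fst -` multifunction_graph F :: (('x \<times> 'y) \<times> real) set)"
    using assms(3) unfolding polyhedral_convex_multifunction_def
    by (rule polyhedral_convex_set_vimage) (auto simp: linear_iff intro: continuous_intros)
  then have "polyhedral_convex_set P"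
    using assms(2) unfolding P_def polyhedral_convex_fun_def
    by (intro polyhedral_convex_set_Int)
  then have "polyhedral_convex_set {(x, r). \<exists>y. ((x, y), r) \<in> P}"
    by (rule polyhedral_convex_set_project_middle)
  also have "{(x, r). \<exists>y. ((x, y), r) \<in> P} =
      {(x, r). \<exists>y. \<phi> (x, y) \<le> ereal r \<and> y \<in> F x}"
    by (auto simp: P_def epi_def multifunction_graph_def)
  finally have Q: "polyhedral_convex_set {(x, r). \<exists>y. \<phi> (x, y) \<le> ereal r \<and> y \<in> F x}" .
  then show ?thesis
    unfolding polyhedral_convex_fun_def
    by (simp add: epi_optimal_value closed_polyhedral_convex_set)
qed

end
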